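(* Let $\mathcal{C}\subseteq\mathbb{R}^d$ be nonempty, closed, and convex, and let $R(a)=\Pi_{\mathcal{C}}(a)$ denote the Euclidean projection of $a\in\mathbb{R}^d$ onto $\mathcal{C}$. Then $R(a)\in\mathcal{C}$ for every $a\in\mathbb{R}^d$. Moreover, let $\mathcal{D}\subseteq\mathbb{R}^d$ be the raw action domain, fix a state $x$ and a leader signal $\ell$, and suppose that $U_L(x,\ell,\cdot)$ is a real-valued $L_U$-Lipschitz function (on a set containing $\mathcal{D}\cup\mathcal{C}$). Then for every $a\in\mathcal{D}$, $$U_L(x,\ell,R(a))\ \ge\ U_L(x,\ell,a)-L_U\,\|R(a)-a\|.$$ If in addition $\sup_{a\in\mathcal{D}}\|R(a)-a\|\le d_{\max}$, then the loss is at most $L_U d_{\max}$, i.e. $U_L(x,\ell,a)-U_L(x,\ell,R(a))\le L_U d_{\max}$ for every $a\in\mathcal{D}$.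
   Context: $U_L(x,\ell,a)$ is the leader's utility at state $x$, leader signal $\ell$ and action $a$. $\|\cdot\|$ is the Euclidean norm on $\mathbb{R}^d$. The Euclidean projection $\Pi_{\mathcal{C}}(a)$ is the (unique) point of $\mathcal{C}$ at minimal Euclidean distance from $a$. "$L_U$-Lipschitz" means $|U_L(x,\ell,a)-U_L(x,\ell,a')|\le L_U\|a-a'\|$ for all $a,a'$ in the domain, where $L_U\ge0$. *)

theory Defs
  imports "HOL-Analysis.Analysis"
begin

end

theory Submission
  imports Defs
begin

text \<open>A nonempty closed set in Euclidean space attains its distance to every point, so
  projections land in \<open>C\<close> (\<open>closest_point_in_set\<close>). Hence \<open>a\<close>
  and its projection both lie in \<open>S\<close>, where the utility is Lipschitz, and the Lipschitz
  inequality for this pair bounds the loss by \<open>L\<^sub>U\<close> times the displacement. This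
  one bound, \<open>loss\<close>, carries the rest: rearranged it is the lower bound on utility, and
  bounding the displacement by \<open>d_max\<close> gives the uniform estimate.\<close>

theorem proposition5p3:
  fixes C D S :: "(real ^ 'd) set"
    and U\<^sub>L :: "'x \<Rightarrow> 'l \<Rightarrow> real ^ 'd \<Rightarrow> real"
    and x :: 'x and l :: 'l
    and L\<^sub>U d_max :: real
  assumes "C \<noteq> {}" and "closed C" and "convex C"
  shows "(\<forall>a. closest_point C a \<in> C) \<and>
    (D \<union> C \<subseteq> S \<longrightarrow> L\<^sub>U-lipschitz_on S (U\<^sub>L x l) \<longrightarrow>
      (\<forall>a\<in>D. U\<^sub>L x l (closest_point C a) \<ge> U\<^sub>L x l a - L\<^sub>U * norm (closest_point C a - a)) \<and>
      ((SUP a\<in>D. ereal (norm (closest_point C a - a))) \<le> ereal d_max \<longrightarrow>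
        (\<forall>a\<in>D. U\<^sub>L x l a - U\<^sub>L x l (closest_point C a) \<le> L\<^sub>U * d_max)))"
proof (intro conjI impI)
  show mem: "\<forall>a. closest_point C a \<in> C"
    using assms closest_point_in_set by blast
  assume sub: "D \<union> C \<subseteq> S" and lip: "L\<^sub>U-lipschitz_on S (U\<^sub>L x l)"
  have loss: "U\<^sub>L x l a - U\<^sub>L x l (closest_point C a) \<le> L\<^sub>U * norm (closest_point C a - a)"
    if "a \<in> D" for a
  proof -
    have "a \<in> S" "closest_point C a \<in> S"
      using that sub mem by auto
    then have "dist (U\<^sub>L x l (closest_point C a)) (U\<^sub>L x l a) \<le> L\<^sub>U * dist (closest_point C a) a"
      using lip by (intro lipschitz_onD)
    \<comment> \<open>On the reals \<open>dist\<close> is an absolute value; only one of its two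
      signs is kept.\<close>
    then show ?thesis
      by (simp add: dist_norm)
  qed
  show "\<forall>a\<in>D. U\<^sub>L x l (closest_point C a) \<ge> U\<^sub>L x l a - L\<^sub>U * norm (closest_point C a - a)"
    using loss by (simp add: algebra_simps)
  assume sup: "(SUP a\<in>D. ereal (norm (closest_point C a - a))) \<le> ereal d_max"
  show "\<forall>a\<in>D. U\<^sub>L x l a - U\<^sub>L x l (closest_point C a) \<le> L\<^sub>U * d_max"
  proof
    fix a assume a: "a \<in> D"
    \<comment> \<open>The supremum is taken in \<open>ereal\<close>, a complete lattice, so it
      bounds every member with no separate boundedness proof; an unbounded family would have
      supremum \<infinity>, contradicting \<open>sup\<close>.\<close>
    have "norm (closest_point C a - a) \<le> d_max"
      using sup a by (simp add: SUP_le_iff)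
    \<comment> \<open>Monotonicity needs a nonnegative factor, and nonnegativity of the constant is
      part of \<open>lipschitz_on\<close>.\<close>
    then have "L\<^sub>U * norm (closest_point C a - a) \<le> L\<^sub>U * d_max"
      using lipschitz_on_nonneg[OF lip] by (rule mult_left_mono)
    with loss[OF a] show "U\<^sub>L x l a - U\<^sub>L x l (closest_point C a) \<le> L\<^sub>U * d_max"
      by linarith
  qed
qed

end
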